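(* Let $(X,X^+)$ and $(X^*,(X^* )^+)$ be separable Banach lattices of dimension at least $2$. Let $\Phi^{(1)}=((U^{(1)}_\omega(t))_{\omega\in\Omega,t\in\mathbb T^+},(\theta_t)_{t\in\mathbb T})$ and $\Phi^{(2)}=((U^{(2)}_\omega(t))_{\omega\in\Omega,t\in\mathbb T^+},(\theta_t)_{t\in\mathbb T})$ be two measurable linear skew-product semidynamical systems on $X$ covering the same $(\theta_t)_{t\in\mathbb T}$ such that $$U^{(1)}_\omega(t_0)u\le U^{(2)}_\omega(t_0)u$$ for some $t_0\in\mathbb T^+\setminus\{0\}$, $\mathbb P$-a.e. $\omega\in\Omega$ and all $u\in X^+$. Assume that both $\Phi^{(1)}$ and $\Phi^{(2)}$ are integrable and positive, have duals that are dual-integrable and dual-positive, and are strongly focusing. Then $$\tilde\lambda_1^{(1)}\le\tilde\lambda_1^{(2)},$$ where $\tilde\lambda_1^{(i)}$ denotes the generalized principal Lyapunov exponent of $\Phi^{(i)}$, $i=1,2$.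
   Context: Let $\mathbb T\in\{\mathbb Z,\mathbb R\}$, $\mathbb T^+=\{t\in\mathbb T:t\ge0\}$. $(\Omega,\mathfrak F,\mathbb P)$ is a probability space; $\mathfrak B(Y)$ is the Borel $\sigma$-algebra of a metric space $Y$. A metric dynamical system $(\theta_t)_{t\in\mathbb T}$ is a $(\mathfrak B(\mathbb T)\otimes\mathfrak F,\mathfrak F)$-measurable map $(t,\omega)\mapsto\theta_t\omega$ with $\theta_0=\mathrm{Id}$, $\theta_{t_1+t_2}=\theta_{t_2}\circ\theta_{t_1}$, each $\theta_t$ preserving $\mathbb P$. $\Omega'\subset\Omega$ is invariant if $\theta_t(\Omega')=\Omega'$ for all $t\in\mathbb T$; the system is ergodic if every invariant $F\in\mathfrak F$ has $\mathbb P(F)\in\{0,1\}$. A measurable linear skew-product semidynamical system $\Phi=((U_\omega(t)),(\theta_t))$ on a real Banach space $X$ covering $(\theta_t)$ is a $(\mathfrak B(\mathbb T^+)\otimes\mathfrak F\otimes\mathfrak B(X),\mathfrak B(X))$-measurable map $(t,\omega,u)\mapsto U_\omega(t)u$ with each $U_\omega(t)$ bounded linear on $X$, $U_\omega(0)=\mathrm{Id}_X$ and $U_{\theta_s\omega}(t)U_\omega(s)=U_\omega(t+s)$. Write $\ln^+x=\max(\ln x,0)$, $\ln^+0=0$. A cone in $X$ is a closed convex set $X^+$ with $\alpha u\in X^+$ for $\alpha\ge0$, $u\in X^+$, and $X^+\cap(-X^+)=\{0\}$; $u\le v$ means $v-u\in X^+$. For $u,v\in X^+\setminus\{0\}$,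 $u\sim v$ means $\underline\alpha v\le u\le\overline\alpha v$ for some $\underline\alpha,\overline\alpha>0$, and $C_u=\{v\in X^+\setminus\{0\}:v\sim u\}$. For a Banach lattice the norm is a lattice norm ($|u|\le|v|$ implies $\|u\|\le\|v\|$). $X^*$ carries the dual norm, pairing $\langle u,u^*\rangle$, and $(X^* )^+=\{u^*:\langle u,u^*\rangle\ge0\ \forall u\in X^+\}$. $U^*_\omega(t)$ is defined by $\langle u,U^*_\omega(t)u^*\rangle=\langle U_{\theta_{-t}\omega}(t)u,u^*\rangle$; when $(t,\omega,u^* )\mapsto U^*_\omega(t)u^*$ is $(\mathfrak B(\mathbb T^+)\otimes\mathfrak F\otimes\mathfrak B(X^* ),\mathfrak B(X^* ))$-measurable, $\Phi^*=((U^*_\omega(t)),(\theta_{-t}))$ is the dual of $\Phi$ (a measurable linear skew-product semidynamical system on $X^*$ covering $(\theta_{-t})$). $\Phi$ is integrable if $X$ is separable, $(\theta_t)$ is ergodic, $\mathbb P$ is complete when $\mathbb T=\mathbb R$, and: when $\mathbb T=\mathbb Z$, $\omega\mapsto\ln^+\|U_\omega(1)\|$ is in $L_1$; when $\mathbb T=\mathbb R$, $\omega\mapsto\sup_{0\le s\le1}\ln^+\|U_\omega(s)\|$ and $\omega\mapsto\sup_{0\le s\le1}\ln^+\|U_{\theta_s\omega}(1-s)\|$ are in $L_1$. It is positive if $U_\omega(t)u_1\le U_\omega(t)u_2$ for all $\omega$, all $t\in\mathbb T^+$ and all $u_1\le u_2$. Dual-integrable and dual-positive mean that $\Phi^*$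 (with the measurability above) has the same properties on $X^*$ with $(\theta_{-t})$ in place of $(\theta_t)$. $\Phi$ is strongly focusing if there are $\mathbf e\in X^+$, $\mathbf e^*\in(X^* )^+$ of norm $1$ with $\langle\mathbf e,\mathbf e^*\rangle>0$ and measurable $\varkappa,\varkappa^*:\Omega\to[1,\infty)$ with $\ln\varkappa,\ln\varkappa^*\in L_1$ such that for each $\omega\in\Omega$, nonzero $u\in X^+$ and nonzero $u^*\in(X^* )^+$ there are $\beta(\omega,u)>0$, $\beta^*(\omega,u^* )>0$ with $\beta(\omega,u)\mathbf e\le U_\omega(1)u\le\varkappa(\omega)\beta(\omega,u)\mathbf e$ and $\beta^*(\omega,u^* )\mathbf e^*\le U^*_\omega(1)u^*\le\varkappa^*(\omega)\beta^*(\omega,u^* )\mathbf e^*$ (the data may differ for $\Phi^{(1)}$ and $\Phi^{(2)}$). Generalized principal Lyapunov exponent. Under these hypotheses on $\Phi$ there exist an invariant $\tilde\Omega_1$ with $\mathbb P(\tilde\Omega_1)=1$, a measurable $w:\tilde\Omega_1\to X$ with $w(\omega)\in C_{\mathbf e}$, $\|w(\omega)\|=1$, $w(\theta_t\omega)=U_\omega(t)w(\omega)/\|U_\omega(t)w(\omega)\|$ for $\omega\in\tilde\Omega_1$, $t\in\mathbb T^+$, and a number $\tilde\lambda_1\in[-\infty,\infty)$ with $\tilde\lambda_1=\lim_{t\to\infty,\,t\in\mathbb T^+}\frac1t\ln\|U_\omega(t)w(\omega)\|=\int_\Omega\ln\|U_\cdot(1)w(\cdot)\|\,d\mathbb P$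 for every $\omega\in\tilde\Omega_1$; this $\tilde\lambda_1$ is the generalized principal Lyapunov exponent of $\Phi$. *)

theory Defs
  imports "HOL-Probability.Probability"
begin

section \<open>Ordered Banach spaces\<close>

text \<open>The order of a Banach space is carried by an explicit cone \<open>K\<close> (the set \<open>X\<^sup>+\<close>), not by a
  type class, so that the same notions apply to \<open>X\<close> and to its dual \<open>'x \<Rightarrow>\<^sub>L real\<close>.\<close>

definition order_cone :: "'x::real_normed_vector set \<Rightarrow> bool" where
  "order_cone K \<longleftrightarrow> closed K \<and> convex K \<and> cone K \<and> K \<inter> uminus ` K = {0}"

definition cone_le :: "'x::real_normed_vector set \<Rightarrow> 'x \<Rightarrow> 'x \<Rightarrow> bool" where
  "cone_le K u v \<longleftrightarrow> v - u \<in> K"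

definition is_cone_sup :: "'x::real_normed_vector set \<Rightarrow> 'x \<Rightarrow> 'x \<Rightarrow> 'x \<Rightarrow> bool" where
  "is_cone_sup K u v s \<longleftrightarrow>
     cone_le K u s \<and> cone_le K v s \<and> (\<forall>z. cone_le K u z \<and> cone_le K v z \<longrightarrow> cone_le K s z)"

text \<open>Binary infima need no separate clause: the infimum of \<open>u\<close> and \<open>v\<close> is the negative of the
  supremum of \<open>- u\<close> and \<open>- v\<close>. In the last clause \<open>a\<close> and \<open>b\<close> are \<open>|u|\<close> and \<open>|v|\<close>.\<close>

definition banach_lattice :: "'x::banach set \<Rightarrow> bool" where
  "banach_lattice K \<longleftrightarrow>
     order_cone K \<and>
     (\<forall>u v. \<exists>s. is_cone_sup K u v s) \<and>
     (\<forall>u v a b. is_cone_sup K u (- u) a \<and> is_cone_sup K v (- v) b \<and> cone_le K a b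
        \<longrightarrow> norm u \<le> norm v)"

definition comparable :: "'x::real_normed_vector set \<Rightarrow> 'x \<Rightarrow> 'x \<Rightarrow> bool" where
  "comparable K u v \<longleftrightarrow>
     (\<exists>l r::real. 0 < l \<and> 0 < r \<and> cone_le K (l *\<^sub>R v) u \<and> cone_le K u (r *\<^sub>R v))"

definition cone_component :: "'x::real_normed_vector set \<Rightarrow> 'x \<Rightarrow> 'x set" where
  "cone_component K u = {v \<in> K - {0}. comparable K v u}"

definition dual_cone :: "'x::real_normed_vector set \<Rightarrow> ('x \<Rightarrow>\<^sub>L real) set" where
  "dual_cone K = {f. \<forall>u\<in>K. 0 \<le> blinfun_apply f u}"

text \<open>The library's \<open>dim\<close> is \<open>0\<close> on infinite-dimensional spaces, hence the formulation by an
  independent pair.\<close>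

definition dim_at_least_2 :: "'x::real_vector itself \<Rightarrow> bool" where
  "dim_at_least_2 _ \<longleftrightarrow> (\<exists>B::'x set. independent B \<and> card B = 2)"


section \<open>Metric dynamical systems\<close>

text \<open>The time set \<open>T\<close> is \<open>\<int>\<close> or \<open>\<real>\<close>, both as sets of reals, with the trace of the Borel
  sigma-algebra of the reals.\<close>

definition nonneg_times :: "real set \<Rightarrow> real set" where
  "nonneg_times T = {t \<in> T. 0 \<le> t}"

locale metric_dynamical_system = prob_space M
  for M :: "'w measure" and T :: "real set" and \<theta> :: "real \<Rightarrow> 'w \<Rightarrow> 'w" +
  assumes time_set: "T = \<int> \<or> T = \<real>"
    and flow_measurable:
      "(\<lambda>(t, \<omega>). \<theta> t \<omega>) \<in> measurable (restrict_space borel T \<Otimes>\<^sub>M M) M"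
    and flow_zero: "\<omega> \<in> space M \<Longrightarrow> \<theta> 0 \<omega> = \<omega>"
    and flow_add: "s \<in> T \<Longrightarrow> t \<in> T \<Longrightarrow> \<omega> \<in> space M \<Longrightarrow> \<theta> (s + t) \<omega> = \<theta> t (\<theta> s \<omega>)"
    and flow_preserves: "t \<in> T \<Longrightarrow> distr M M (\<theta> t) = M"

definition invariant_set ::
    "'w measure \<Rightarrow> real set \<Rightarrow> (real \<Rightarrow> 'w \<Rightarrow> 'w) \<Rightarrow> 'w set \<Rightarrow> bool" where
  "invariant_set M T \<theta> A \<longleftrightarrow> A \<subseteq> space M \<and> (\<forall>t\<in>T. \<theta> t ` A = A)"

definition ergodic_flow :: "'w measure \<Rightarrow> real set \<Rightarrow> (real \<Rightarrow> 'w \<Rightarrow> 'w) \<Rightarrow> bool" where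
  "ergodic_flow M T \<theta> \<longleftrightarrow>
     (\<forall>F\<in>sets M. invariant_set M T \<theta> F \<longrightarrow> measure M F = 0 \<or> measure M F = 1)"


section \<open>Measurable linear skew-product semidynamical systems\<close>

locale skew_product = metric_dynamical_system M T \<theta>
  for M :: "'w measure" and T :: "real set" and \<theta> :: "real \<Rightarrow> 'w \<Rightarrow> 'w"
    and U :: "'w \<Rightarrow> real \<Rightarrow> ('x::banach \<Rightarrow>\<^sub>L 'x)" +
  assumes cocycle_measurable:
      "(\<lambda>(t, \<omega>, u). blinfun_apply (U \<omega> t) u)
         \<in> borel_measurable (restrict_space borel (nonneg_times T) \<Otimes>\<^sub>M M \<Otimes>\<^sub>M borel)"
    and cocycle_zero: "\<omega> \<in> space M \<Longrightarrow> U \<omega> 0 = id_blinfun"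
    and cocycle_add:
      "s \<in> nonneg_times T \<Longrightarrow> t \<in> nonneg_times T \<Longrightarrow> \<omega> \<in> space M \<Longrightarrow>
         U (\<theta> s \<omega>) t o\<^sub>L U \<omega> s = U \<omega> (t + s)"

definition ln_plus :: "real \<Rightarrow> real" where
  "ln_plus x = (if x \<le> 0 then 0 else max (ln x) 0)"

text \<open>For real time the suprema are taken in the extended half line, so that membership in \<open>L\<^sub>1\<close>
  forces them to be finite only almost everywhere; a real-valued supremum would have an
  unspecified value where the set is unbounded.\<close>

definition integrable_sds ::
    "'w measure \<Rightarrow> real set \<Rightarrow> (real \<Rightarrow> 'w \<Rightarrow> 'w) \<Rightarrow> ('w \<Rightarrow> real \<Rightarrow> ('x::banach \<Rightarrow>\<^sub>L 'x)) \<Rightarrow> bool"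
  where
  "integrable_sds M T \<theta> U \<longleftrightarrow>
     separable_space (euclidean :: 'x topology) \<and>
     ergodic_flow M T \<theta> \<and>
     (T = \<int> \<longrightarrow> integrable M (\<lambda>\<omega>. ln_plus (norm (U \<omega> 1)))) \<and>
     (T = \<real> \<longrightarrow>
        complete_measure M \<and>
        (let f = (\<lambda>\<omega>. SUP s\<in>{0..1}. ennreal (ln_plus (norm (U \<omega> s))));
             g = (\<lambda>\<omega>. SUP s\<in>{0..1}. ennreal (ln_plus (norm (U (\<theta> s \<omega>) (1 - s)))))
         in f \<in> borel_measurable M \<and> (\<integral>\<^sup>+ \<omega>. f \<omega> \<partial>M) < \<infinity> \<and>
            g \<in> borel_measurable M \<and> (\<integral>\<^sup>+ \<omega>. g \<omega> \<partial>M) < \<infinity>))"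

definition positive_sds ::
    "'w measure \<Rightarrow> real set \<Rightarrow> 'x::banach set \<Rightarrow> ('w \<Rightarrow> real \<Rightarrow> ('x \<Rightarrow>\<^sub>L 'x)) \<Rightarrow> bool" where
  "positive_sds M T K U \<longleftrightarrow>
     (\<forall>\<omega>\<in>space M. \<forall>t\<in>nonneg_times T. \<forall>u v.
        cone_le K u v \<longrightarrow> cone_le K (blinfun_apply (U \<omega> t) u) (blinfun_apply (U \<omega> t) v))"


section \<open>The dual system\<close>

definition adjoint_op :: "('x::banach \<Rightarrow>\<^sub>L 'x) \<Rightarrow> (('x \<Rightarrow>\<^sub>L real) \<Rightarrow>\<^sub>L ('x \<Rightarrow>\<^sub>L real))" where
  "adjoint_op A = Blinfun (\<lambda>f. f o\<^sub>L A)"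

lemma adjoint_op_apply: "blinfun_apply (adjoint_op A) f = f o\<^sub>L A"
  unfolding adjoint_op_def
  by (simp add: bounded_linear_Blinfun_apply
      bounded_bilinear.bounded_linear_left[OF bounded_bilinear_blinfun_compose])

definition dual_cocycle ::
    "(real \<Rightarrow> 'w \<Rightarrow> 'w) \<Rightarrow> ('w \<Rightarrow> real \<Rightarrow> ('x::banach \<Rightarrow>\<^sub>L 'x))
       \<Rightarrow> 'w \<Rightarrow> real \<Rightarrow> (('x \<Rightarrow>\<^sub>L real) \<Rightarrow>\<^sub>L ('x \<Rightarrow>\<^sub>L real))" where
  "dual_cocycle \<theta> U \<omega> t = adjoint_op (U (\<theta> (- t) \<omega>) t)"

lemma dual_cocycle_pairing:
  "blinfun_apply (blinfun_apply (dual_cocycle \<theta> U \<omega> t) f) u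
     = blinfun_apply f (blinfun_apply (U (\<theta> (- t) \<omega>) t) u)"
  by (simp add: dual_cocycle_def adjoint_op_apply)

definition has_dual ::
    "'w measure \<Rightarrow> real set \<Rightarrow> (real \<Rightarrow> 'w \<Rightarrow> 'w) \<Rightarrow> ('w \<Rightarrow> real \<Rightarrow> ('x::banach \<Rightarrow>\<^sub>L 'x)) \<Rightarrow> bool"
  where
  "has_dual M T \<theta> U \<longleftrightarrow>
     (\<lambda>(t, \<omega>, f). blinfun_apply (dual_cocycle \<theta> U \<omega> t) f)
       \<in> borel_measurable (restrict_space borel (nonneg_times T) \<Otimes>\<^sub>M M \<Otimes>\<^sub>M borel)"

lemma (in metric_dynamical_system) flow_in_space:
  assumes "t \<in> T" "\<omega> \<in> space M"
  shows "\<theta> t \<omega> \<in> space M"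
  using measurable_space[OF flow_measurable, of "(t, \<omega>)"] assms
  by (simp add: space_pair_measure space_restrict_space)

lemma (in metric_dynamical_system) uminus_time: "t \<in> T \<Longrightarrow> - t \<in> T"
  using time_set by (auto simp: Reals_minus_iff)

lemma (in metric_dynamical_system) reversed_flow:
  "metric_dynamical_system M T (\<lambda>t. \<theta> (- t))"
proof
  show "T = \<int> \<or> T = \<real>" by (rule time_set)
  have neg: "uminus \<in> measurable (restrict_space borel T) (restrict_space borel T)"
    by (rule measurable_restrict_space2)
      (auto simp: space_restrict_space uminus_time intro!: measurable_restrict_space1)
  have "(\<lambda>p. (- fst p, snd p))
      \<in> measurable (restrict_space borel T \<Otimes>\<^sub>M M) (restrict_space borel T \<Otimes>\<^sub>M M)"
    by (rule measurable_Pair) (use measurable_compose[OF measurable_fst neg] in auto)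
  from measurable_compose[OF this flow_measurable]
  show "(\<lambda>(t, \<omega>). \<theta> (- t) \<omega>) \<in> measurable (restrict_space borel T \<Otimes>\<^sub>M M) M"
    by (simp add: case_prod_beta)
  show "\<theta> (- (s + t)) \<omega> = \<theta> (- t) (\<theta> (- s) \<omega>)" if "s \<in> T" "t \<in> T" "\<omega> \<in> space M" for s t \<omega>
    using flow_add[of "- s" "- t" \<omega>] that uminus_time by (simp add: algebra_simps)
qed (use flow_zero flow_preserves uminus_time in auto)

lemma (in skew_product) dual_skew_product:
  assumes "has_dual M T \<theta> U"
  shows "skew_product M T (\<lambda>t. \<theta> (- t)) (dual_cocycle \<theta> U)"
proof -
  interpret rev: metric_dynamical_system M T "\<lambda>t. \<theta> (- t)"
    by (rule reversed_flow)
  show ?thesis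
  proof
    show "(\<lambda>(t, \<omega>, f). blinfun_apply (dual_cocycle \<theta> U \<omega> t) f)
       \<in> borel_measurable (restrict_space borel (nonneg_times T) \<Otimes>\<^sub>M M \<Otimes>\<^sub>M borel)"
      using assms by (simp add: has_dual_def)
    show "dual_cocycle \<theta> U \<omega> 0 = id_blinfun" if "\<omega> \<in> space M" for \<omega>
      by (intro blinfun_eqI) (simp add: dual_cocycle_pairing flow_zero cocycle_zero that)
    show "dual_cocycle \<theta> U (\<theta> (- s) \<omega>) t o\<^sub>L dual_cocycle \<theta> U \<omega> s = dual_cocycle \<theta> U \<omega> (t + s)"
      if s: "s \<in> nonneg_times T" and t: "t \<in> nonneg_times T" and w: "\<omega> \<in> space M" for s t \<omega>
    proof (intro blinfun_eqI)
      fix f u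
      let ?w = "\<theta> (- t) (\<theta> (- s) \<omega>)"
      have T: "- s \<in> T" "- t \<in> T" "t \<in> T"
        using s t uminus_time by (auto simp: nonneg_times_def)
      have w1: "\<theta> (- s) \<omega> \<in> space M" and w2: "?w \<in> space M"
        using T w flow_in_space by auto
      have e1: "?w = \<theta> (- (t + s)) \<omega>"
        using flow_add[OF T(1) T(2) w] by (metis minus_add_distrib add.commute)
      have e2: "\<theta> t ?w = \<theta> (- s) \<omega>"
        using flow_add[OF T(2) T(3) w1] flow_zero[OF w1] by simp
      have "U (\<theta> t ?w) s o\<^sub>L U ?w t = U ?w (s + t)"
        by (rule cocycle_add[OF t s w2])
      then have "blinfun_apply (U (\<theta> (- s) \<omega>) s) (blinfun_apply (U ?w t) u)
          = blinfun_apply (U ?w (t + s)) u"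
        unfolding e2 by (metis add.commute blinfun_apply_blinfun_compose)
      then show "blinfun_apply (blinfun_apply
            (dual_cocycle \<theta> U (\<theta> (- s) \<omega>) t o\<^sub>L dual_cocycle \<theta> U \<omega> s) f) u
          = blinfun_apply (blinfun_apply (dual_cocycle \<theta> U \<omega> (t + s)) f) u"
        unfolding blinfun_apply_blinfun_compose dual_cocycle_pairing e1[symmetric] by simp
    qed
  qed
qed

definition dual_integrable_sds ::
    "'w measure \<Rightarrow> real set \<Rightarrow> (real \<Rightarrow> 'w \<Rightarrow> 'w) \<Rightarrow> ('w \<Rightarrow> real \<Rightarrow> ('x::banach \<Rightarrow>\<^sub>L 'x)) \<Rightarrow> bool"
  where
  "dual_integrable_sds M T \<theta> U \<longleftrightarrow>
     has_dual M T \<theta> U \<and> integrable_sds M T (\<lambda>t. \<theta> (- t)) (dual_cocycle \<theta> U)"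

definition dual_positive_sds ::
    "'w measure \<Rightarrow> real set \<Rightarrow> (real \<Rightarrow> 'w \<Rightarrow> 'w) \<Rightarrow> 'x::banach set
       \<Rightarrow> ('w \<Rightarrow> real \<Rightarrow> ('x \<Rightarrow>\<^sub>L 'x)) \<Rightarrow> bool" where
  "dual_positive_sds M T \<theta> K U \<longleftrightarrow>
     has_dual M T \<theta> U \<and> positive_sds M T (dual_cone K) (dual_cocycle \<theta> U)"


section \<open>Strong focusing and the generalized principal Lyapunov exponent\<close>

definition focusing_towards ::
    "'w measure \<Rightarrow> 'x::banach set \<Rightarrow> ('w \<Rightarrow> real \<Rightarrow> ('x \<Rightarrow>\<^sub>L 'x)) \<Rightarrow> 'x \<Rightarrow> ('w \<Rightarrow> real) \<Rightarrow> bool" where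
  "focusing_towards M K U e \<kappa> \<longleftrightarrow>
     \<kappa> \<in> borel_measurable M \<and> (\<forall>\<omega>\<in>space M. 1 \<le> \<kappa> \<omega>) \<and> integrable M (\<lambda>\<omega>. ln (\<kappa> \<omega>)) \<and>
     (\<forall>\<omega>\<in>space M. \<forall>u\<in>K - {0}. \<exists>\<beta>>0.
        cone_le K (\<beta> *\<^sub>R e) (blinfun_apply (U \<omega> 1) u) \<and>
        cone_le K (blinfun_apply (U \<omega> 1) u) ((\<kappa> \<omega> * \<beta>) *\<^sub>R e))"

text \<open>The vector \<open>e\<close> is kept as a parameter because the component \<open>C\<^sub>e\<close> enters the
  characterization of the generalized principal Lyapunov exponent.\<close>

definition strongly_focusing ::
    "'w measure \<Rightarrow> (real \<Rightarrow> 'w \<Rightarrow> 'w) \<Rightarrow> 'x::banach set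
       \<Rightarrow> ('w \<Rightarrow> real \<Rightarrow> ('x \<Rightarrow>\<^sub>L 'x)) \<Rightarrow> 'x \<Rightarrow> bool" where
  "strongly_focusing M \<theta> K U e \<longleftrightarrow>
     (\<exists>e' \<kappa> \<kappa>'.
        e \<in> K \<and> norm e = 1 \<and> e' \<in> dual_cone K \<and> norm e' = 1 \<and> 0 < blinfun_apply e' e \<and>
        focusing_towards M K U e \<kappa> \<and>
        focusing_towards M (dual_cone K) (dual_cocycle \<theta> U) e' \<kappa>')"

text \<open>Extended-real integral: positive part minus negative part (\<open>ennreal\<close> maps negative numbers
  to \<open>0\<close>). It is \<open>\<infinity>\<close> as soon as the positive part has infinite integral, so a value below \<open>\<infinity>\<close>
  entails that the integral is well defined in \<open>[-\<infinity>, \<infinity>)\<close>.\<close>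

definition ext_integral :: "'w measure \<Rightarrow> ('w \<Rightarrow> real) \<Rightarrow> ereal" where
  "ext_integral M f =
     enn2ereal (\<integral>\<^sup>+ \<omega>. ennreal (f \<omega>) \<partial>M) - enn2ereal (\<integral>\<^sup>+ \<omega>. ennreal (- f \<omega>) \<partial>M)"

text \<open>The function \<open>w\<close> matters only on the full-measure set \<open>\<Omega>\<^sub>1\<close>; the integral over the whole
  space is therefore taken over \<open>\<Omega>\<^sub>1\<close>. Since \<open>w (\<theta> t \<omega>)\<close> is a unit vector,
  \<open>U \<omega> t (w \<omega>) \<noteq> 0\<close>, so \<open>ln 0\<close> does not occur.\<close>

definition gen_principal_lyapunov_exponent ::
    "'w measure \<Rightarrow> real set \<Rightarrow> (real \<Rightarrow> 'w \<Rightarrow> 'w) \<Rightarrow> 'x::banach set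
       \<Rightarrow> ('w \<Rightarrow> real \<Rightarrow> ('x \<Rightarrow>\<^sub>L 'x)) \<Rightarrow> 'x \<Rightarrow> ereal \<Rightarrow> bool" where
  "gen_principal_lyapunov_exponent M T \<theta> K U e lam \<longleftrightarrow> lam < \<infinity> \<and>
     (\<exists>\<Omega>\<^sub>1 w.
        \<Omega>\<^sub>1 \<in> sets M \<and> invariant_set M T \<theta> \<Omega>\<^sub>1 \<and> measure M \<Omega>\<^sub>1 = 1 \<and>
        w \<in> borel_measurable (restrict_space M \<Omega>\<^sub>1) \<and>
        (\<forall>\<omega>\<in>\<Omega>\<^sub>1. w \<omega> \<in> cone_component K e \<and> norm (w \<omega>) = 1 \<and>
           (\<forall>t\<in>nonneg_times T.
              w (\<theta> t \<omega>) = blinfun_apply (U \<omega> t) (w \<omega>) /\<^sub>R norm (blinfun_apply (U \<omega> t) (w \<omega>)))) \<and>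
        (\<forall>\<omega>\<in>\<Omega>\<^sub>1. ((\<lambda>t. ereal (1 / t * ln (norm (blinfun_apply (U \<omega> t) (w \<omega>))))) \<longlongrightarrow> lam)
           (inf at_top (principal (nonneg_times T)))) \<and>
        lam = ext_integral (restrict_space M \<Omega>\<^sub>1)
               (\<lambda>\<omega>. ln (norm (blinfun_apply (U \<omega> 1) (w \<omega>)))))"

end

theory Submission
  imports Defs
begin

text \<open>The argument is pathwise: one good \<open>\<omega>\<close> decides the inequality, because both exponents are
  limits along every orbit of a set of full measure.

  Two facts carry it. Since the flow preserves the measure, almost every \<open>\<omega>\<close> satisfies the
  one-step domination at all points \<open>\<theta> (n t\<^sub>0) \<omega>\<close> of its \<open>t\<^sub>0\<close>-orbit, and positivity then turns it
  into domination of \<open>U\<^sub>1\<close> by \<open>U\<^sub>2\<close> on the cone at all times \<open>n t\<^sub>0\<close>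
  (\<open>cocycle_domination_multiples\<close>). Secondly, after unit time a focusing cocycle maps all nonzero
  vectors of the cone to multiples of \<open>e\<close>, up to bounded factors, so their orbits dominate each
  other up to a constant independent of time (\<open>focusing_orbits_comparable\<close>). In particular all
  nonzero vectors of the cone have the same growth rate, which is why it is harmless that the
  principal directions \<open>w\<^sub>1\<close> and \<open>w\<^sub>2\<close> differ and may even lie in different components of the cone.
  Together, with \<open>C\<close> depending on \<open>\<omega>\<close> but not on \<open>n\<close>,
  \<open>U\<^sub>1(n t\<^sub>0) w\<^sub>1 \<le> U\<^sub>2(n t\<^sub>0) w\<^sub>1 \<le> C U\<^sub>2(n t\<^sub>0) w\<^sub>2\<close> for all large \<open>n\<close>. The lattice norm is monotone on the cone, so the norms obey the same inequality; after taking
  logarithms and dividing by \<open>n t\<^sub>0\<close>, the constant disappears in the limit.\<close>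

lemma order_cone_add:
  assumes "order_cone K" "u \<in> K" "v \<in> K"
  shows "u + v \<in> K"
  using assms convex_cone[of K] by (auto simp: order_cone_def)

lemma order_cone_scaleR:
  assumes "order_cone K" "0 \<le> c" "u \<in> K"
  shows "c *\<^sub>R u \<in> K"
  using assms by (auto simp: order_cone_def cone_def)

lemma order_cone_zero: "order_cone K \<Longrightarrow> 0 \<in> K"
  by (auto simp: order_cone_def)

lemma cone_le_trans:
  assumes "order_cone K" "cone_le K u v" "cone_le K v z"
  shows "cone_le K u z"
  using order_cone_add[OF assms(1), of "v - u" "z - v"] assms(2,3) by (simp add: cone_le_def)

lemma cone_le_scaleR:
  assumes "order_cone K" "0 \<le> c" "cone_le K u v"
  shows "cone_le K (c *\<^sub>R u) (c *\<^sub>R v)"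
  using order_cone_scaleR[OF assms(1,2), of "v - u"] assms(3)
  by (simp add: cone_le_def scaleR_diff_right)

lemma is_cone_sup_abs_of_nonneg:
  assumes "order_cone K" "u \<in> K"
  shows "is_cone_sup K u (- u) u"
  using order_cone_add[OF assms(1) assms(2) assms(2)] order_cone_zero[OF assms(1)]
  by (simp add: is_cone_sup_def cone_le_def)

text \<open>Vectors of the cone are their own absolute values, so the lattice norm compares them
  directly.\<close>

lemma banach_lattice_norm_mono:
  assumes K: "banach_lattice K" and "u \<in> K" "cone_le K u v"
  shows "norm u \<le> norm v"
proof -
  have oc: "order_cone K"
    using K by (simp add: banach_lattice_def)
  have "v \<in> K"
    using order_cone_add[OF oc \<open>u \<in> K\<close>, of "v - u"] \<open>cone_le K u v\<close> by (simp add: cone_le_def)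
  with assms is_cone_sup_abs_of_nonneg[OF oc] show ?thesis
    unfolding banach_lattice_def by blast
qed

lemma positive_sds_mono:
  assumes "positive_sds M T K U" "\<omega> \<in> space M" "t \<in> nonneg_times T" "cone_le K u v"
  shows "cone_le K (blinfun_apply (U \<omega> t) u) (blinfun_apply (U \<omega> t) v)"
  using assms by (auto simp: positive_sds_def)

lemma positive_sds_cone:
  assumes "positive_sds M T K U" "\<omega> \<in> space M" "t \<in> nonneg_times T" "u \<in> K"
  shows "blinfun_apply (U \<omega> t) u \<in> K"
  using positive_sds_mono[OF assms(1-3), of 0 u] assms(4) by (simp add: cone_le_def)

context metric_dynamical_system
begin

lemma one_in_nonneg_times: "1 \<in> nonneg_times T"
  using time_set by (auto simp: nonneg_times_def)

lemma nonneg_times_diff: "s \<in> nonneg_times T \<Longrightarrow> t \<in> nonneg_times T \<Longrightarrow> s \<le> t \<Longrightarrow> t - s \<in> nonneg_times T"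
  using time_set by (auto simp: nonneg_times_def intro: Ints_diff Reals_diff)

lemma nonneg_times_multiple: "t \<in> nonneg_times T \<Longrightarrow> real n * t \<in> nonneg_times T"
  using time_set by (auto simp: nonneg_times_def intro!: Ints_mult Reals_mult)

lemma flow_map_measurable:
  assumes "t \<in> T"
  shows "\<theta> t \<in> measurable M M"
proof -
  have "Pair t \<in> measurable M (restrict_space borel T \<Otimes>\<^sub>M M)"
    using assms by (intro measurable_Pair1') (simp add: space_restrict_space)
  from measurable_compose[OF this flow_measurable] show ?thesis
    by simp
qed

lemma AE_along_multiples:
  assumes "t \<in> nonneg_times T" "AE \<omega> in M. P \<omega>"
  shows "AE \<omega> in M. \<forall>n. P (\<theta> (real n * t) \<omega>)"
  unfolding AE_all_countable
proof
  fix n :: nat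
  have T: "real n * t \<in> T"
    using nonneg_times_multiple[OF assms(1)] by (simp add: nonneg_times_def)
  have "AE \<omega> in distr M M (\<theta> (real n * t)). P \<omega>"
    unfolding flow_preserves[OF T] by (rule assms(2))
  then show "AE \<omega> in M. P (\<theta> (real n * t) \<omega>)"
    by (rule AE_distrD[OF flow_map_measurable[OF T]])
qed

end

lemma (in skew_product) cocycle_apply:
  assumes "s \<in> nonneg_times T" "t \<in> nonneg_times T" "\<omega> \<in> space M"
  shows "blinfun_apply (U \<omega> (t + s)) u = blinfun_apply (U (\<theta> s \<omega>) t) (blinfun_apply (U \<omega> s) u)"
  using cocycle_add[OF assms] by (metis blinfun_apply_blinfun_compose)

text \<open>After unit time \<open>u\<close> lies below, and \<open>v\<close> above, a positive multiple of \<open>e\<close>; positivity of the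
  remaining evolution preserves the resulting comparison of \<open>u\<close> with \<open>v\<close>.\<close>

lemma (in skew_product) focusing_orbits_comparable:
  assumes K: "order_cone K" and pos: "positive_sds M T K U"
    and foc: "focusing_towards M K U e \<kappa>"
    and w: "\<omega> \<in> space M" and u: "u \<in> K - {0}" and v: "v \<in> K - {0}"
  shows "\<exists>C>0. \<forall>t\<in>nonneg_times T. 1 \<le> t \<longrightarrow>
           cone_le K (blinfun_apply (U \<omega> t) u) (C *\<^sub>R blinfun_apply (U \<omega> t) v)"
proof -
  have \<kappa>: "1 \<le> \<kappa> \<omega>"
    using foc w by (simp add: focusing_towards_def)
  obtain a where a: "0 < a" "cone_le K (blinfun_apply (U \<omega> 1) u) ((\<kappa> \<omega> * a) *\<^sub>R e)"
    using foc w u unfolding focusing_towards_def by blast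
  obtain b where b: "0 < b" "cone_le K (b *\<^sub>R e) (blinfun_apply (U \<omega> 1) v)"
    using foc w v unfolding focusing_towards_def by blast
  define C where "C = \<kappa> \<omega> * a / b"
  have C: "0 < C"
    using \<kappa> a(1) b(1) by (simp add: C_def)
  have "cone_le K ((\<kappa> \<omega> * a) *\<^sub>R e) (C *\<^sub>R blinfun_apply (U \<omega> 1) v)"
    using cone_le_scaleR[OF K less_imp_le[OF C] b(2)] b(1) by (simp add: C_def)
  then have one: "cone_le K (blinfun_apply (U \<omega> 1) u) (C *\<^sub>R blinfun_apply (U \<omega> 1) v)"
    by (rule cone_le_trans[OF K a(2)])
  have "cone_le K (blinfun_apply (U \<omega> t) u) (C *\<^sub>R blinfun_apply (U \<omega> t) v)"
    if t: "t \<in> nonneg_times T" "1 \<le> t" for t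
  proof -
    have t': "t - 1 \<in> nonneg_times T"
      by (rule nonneg_times_diff[OF one_in_nonneg_times t])
    have "\<theta> 1 \<omega> \<in> space M"
      using one_in_nonneg_times w by (intro flow_in_space) (auto simp: nonneg_times_def)
    from positive_sds_mono[OF pos this t' one] show ?thesis
      using cocycle_apply[OF one_in_nonneg_times t' w] by (simp add: blinfun.scaleR_right)
  qed
  with C show ?thesis
    by blast
qed

text \<open>Positivity of \<open>U1\<close> keeps the orbit of \<open>u\<close> in the cone, where the one-step domination
  applies; positivity of \<open>U2\<close> carries the domination reached so far through the next step.\<close>

lemma cocycle_domination_multiples:
  assumes sds1: "skew_product M T \<theta> U1" and sds2: "skew_product M T \<theta> U2"
    and K: "order_cone K"
    and pos1: "positive_sds M T K U1" and pos2: "positive_sds M T K U2"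
    and t: "t \<in> nonneg_times T" and w: "\<omega> \<in> space M" and u: "u \<in> K"
    and le: "\<And>n v. v \<in> K \<Longrightarrow> cone_le K (blinfun_apply (U1 (\<theta> (real n * t) \<omega>) t) v)
                                  (blinfun_apply (U2 (\<theta> (real n * t) \<omega>) t) v)"
  shows "cone_le K (blinfun_apply (U1 \<omega> (real n * t)) u) (blinfun_apply (U2 \<omega> (real n * t)) u)"
proof (induction n)
  case 0
  show ?case
    using skew_product.cocycle_zero[OF sds1 w] skew_product.cocycle_zero[OF sds2 w]
      order_cone_zero[OF K] by (simp add: cone_le_def)
next
  case (Suc n)
  interpret A: skew_product M T \<theta> U1 by (rule sds1)
  interpret B: skew_product M T \<theta> U2 by (rule sds2)
  let ?s = "real n * t"
  let ?w = "\<theta> ?s \<omega>"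
  have s: "?s \<in> nonneg_times T"
    by (rule A.nonneg_times_multiple[OF t])
  have w': "?w \<in> space M"
    using s w by (intro A.flow_in_space) (auto simp: nonneg_times_def)
  have "cone_le K (blinfun_apply (U1 ?w t) (blinfun_apply (U1 \<omega> ?s) u))
          (blinfun_apply (U2 ?w t) (blinfun_apply (U1 \<omega> ?s) u))"
    by (rule le[OF positive_sds_cone[OF pos1 w s u]])
  then have "cone_le K (blinfun_apply (U1 ?w t) (blinfun_apply (U1 \<omega> ?s) u))
          (blinfun_apply (U2 ?w t) (blinfun_apply (U2 \<omega> ?s) u))"
    by (rule cone_le_trans[OF K _ positive_sds_mono[OF pos2 w' t Suc.IH]])
  then show ?case
    using A.cocycle_apply[OF s t w] B.cocycle_apply[OF s t w] by (simp add: algebra_simps)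
qed

text \<open>The limits are compared along the sampling times \<open>s n\<close>, the only times at which \<open>f\<close> and \<open>g\<close>
  are related; the constant contributes \<open>ln C / s n\<close>, which vanishes.\<close>

lemma growth_rate_le:
  fixes f g :: "real \<Rightarrow> real" and l m :: ereal
  assumes f: "((\<lambda>t. ereal (1 / t * ln (f t))) \<longlongrightarrow> l) F"
    and g: "((\<lambda>t. ereal (1 / t * ln (g t))) \<longlongrightarrow> m) F"
    and s: "filterlim s F sequentially" "filterlim s at_top sequentially"
    and C: "0 < C"
    and le: "\<forall>\<^sub>F n in sequentially. 0 < f (s n) \<and> f (s n) \<le> C * g (s n)"
  shows "l \<le> m"
proof -
  have "((\<lambda>n. ln C / s n) \<longlongrightarrow> 0) sequentially"
    by (intro tendsto_divide_0[OF tendsto_const] filterlim_at_top_imp_at_infinity s(2))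
  then have "((\<lambda>n. ereal (ln C / s n)) \<longlongrightarrow> 0) sequentially"
    by (simp add: zero_ereal_def)
  then have "((\<lambda>n. ereal (1 / s n * ln (g (s n))) + ereal (ln C / s n)) \<longlongrightarrow> m + 0) sequentially"
    by (intro tendsto_add_ereal_general filterlim_compose[OF g s(1)]) auto
  then have lim: "((\<lambda>n. ereal (1 / s n * ln (g (s n))) + ereal (ln C / s n)) \<longlongrightarrow> m) sequentially"
    by simp
  show ?thesis
  proof (rule tendsto_le[OF sequentially_bot lim filterlim_compose[OF f s(1)]])
    from s(2) have "\<forall>\<^sub>F n in sequentially. 0 < s n"
      by (auto simp: filterlim_at_top_dense)
    with le show "\<forall>\<^sub>F n in sequentially. ereal (1 / s n * ln (f (s n)))
        \<le> ereal (1 / s n * ln (g (s n))) + ereal (ln C / s n)"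
    proof eventually_elim
      case (elim n)
      then have g0: "0 < g (s n)"
        using C by (smt (verit) mult_nonneg_nonpos)
      have "ln (f (s n)) \<le> ln (C * g (s n))"
        using elim C g0 by simp
      also have "\<dots> = ln (g (s n)) + ln C"
        using C g0 by (simp add: ln_mult)
      finally have "ln (f (s n)) / s n \<le> (ln (g (s n)) + ln C) / s n"
        using elim by (intro divide_right_mono) auto
      then show ?case
        by (simp add: add_divide_distrib)
    qed
  qed
qed

text \<open>The orbit of \<open>w \<omega>\<close> never vanishes, because its normalization is the unit vector
  \<open>w (\<theta> t \<omega>)\<close>. This keeps the logarithms meaningful.\<close>

lemma (in skew_product) gen_principal_lyapunov_exponent_pathwise:
  assumes "gen_principal_lyapunov_exponent M T \<theta> K U e lam"
  shows "AE \<omega> in M. \<exists>v\<in>K - {0}. (\<forall>t\<in>nonneg_times T. blinfun_apply (U \<omega> t) v \<noteq> 0) \<and>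
           ((\<lambda>t. ereal (1 / t * ln (norm (blinfun_apply (U \<omega> t) v)))) \<longlongrightarrow> lam)
              (inf at_top (principal (nonneg_times T)))"
proof -
  obtain \<Omega>\<^sub>1 w where O: "\<Omega>\<^sub>1 \<in> sets M" "invariant_set M T \<theta> \<Omega>\<^sub>1" "measure M \<Omega>\<^sub>1 = 1"
    and w: "\<And>\<omega>. \<omega> \<in> \<Omega>\<^sub>1 \<Longrightarrow> w \<omega> \<in> cone_component K e \<and> norm (w \<omega>) = 1 \<and>
           (\<forall>t\<in>nonneg_times T.
              w (\<theta> t \<omega>) = blinfun_apply (U \<omega> t) (w \<omega>) /\<^sub>R norm (blinfun_apply (U \<omega> t) (w \<omega>)))"
    and lim: "\<And>\<omega>. \<omega> \<in> \<Omega>\<^sub>1 \<Longrightarrow> ((\<lambda>t. ereal (1 / t * ln (norm (blinfun_apply (U \<omega> t) (w \<omega>))))) \<longlongrightarrow> lam)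
           (inf at_top (principal (nonneg_times T)))"
    using assms unfolding gen_principal_lyapunov_exponent_def by blast
  have nz: "blinfun_apply (U \<omega> t) (w \<omega>) \<noteq> 0" if "\<omega> \<in> \<Omega>\<^sub>1" "t \<in> nonneg_times T" for \<omega> t
  proof
    assume "blinfun_apply (U \<omega> t) (w \<omega>) = 0"
    with w that have "w (\<theta> t \<omega>) = 0"
      by simp
    moreover have "\<theta> t \<omega> \<in> \<Omega>\<^sub>1"
      using O(2) that by (auto simp: invariant_set_def nonneg_times_def)
    ultimately show False
      using w[of "\<theta> t \<omega>"] by simp
  qed
  have "AE \<omega> in M. \<omega> \<in> \<Omega>\<^sub>1"
    using O AE_in_set_eq_1 by simp
  then show ?thesis
  proof eventually_elim
    case (elim \<omega>)
    show ?case
    proof (intro bexI conjI ballI)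
      show "w \<omega> \<in> K - {0}"
        using w[OF elim] by (simp add: cone_component_def)
    qed (use nz lim elim in blast)+
  qed
qed

theorem theorem3p9:
  fixes M :: "'w measure" and T :: "real set" and \<theta> :: "real \<Rightarrow> 'w \<Rightarrow> 'w"
    and K :: "'x::banach set"
    and U1 U2 :: "'w \<Rightarrow> real \<Rightarrow> ('x \<Rightarrow>\<^sub>L 'x)"
    and e1 e2 :: 'x and t0 :: real and lam1 lam2 :: ereal
  assumes lattice: "banach_lattice K"
    and dual_lattice: "banach_lattice (dual_cone K)"
    and sep: "separable_space (euclidean :: 'x topology)"
    and dual_sep: "separable_space (euclidean :: ('x \<Rightarrow>\<^sub>L real) topology)"
    and dim: "dim_at_least_2 TYPE('x)"
    and dual_dim: "dim_at_least_2 TYPE('x \<Rightarrow>\<^sub>L real)"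
    and sds1: "skew_product M T \<theta> U1"
    and sds2: "skew_product M T \<theta> U2"
    and t0: "t0 \<in> nonneg_times T - {0}"
    and le: "AE \<omega> in M. \<forall>u\<in>K. cone_le K (blinfun_apply (U1 \<omega> t0) u) (blinfun_apply (U2 \<omega> t0) u)"
    and int1: "integrable_sds M T \<theta> U1" and int2: "integrable_sds M T \<theta> U2"
    and pos1: "positive_sds M T K U1" and pos2: "positive_sds M T K U2"
    and dint1: "dual_integrable_sds M T \<theta> U1" and dint2: "dual_integrable_sds M T \<theta> U2"
    and dpos1: "dual_positive_sds M T \<theta> K U1" and dpos2: "dual_positive_sds M T \<theta> K U2"
    and foc1: "strongly_focusing M \<theta> K U1 e1" and foc2: "strongly_focusing M \<theta> K U2 e2"
    and gple1: "gen_principal_lyapunov_exponent M T \<theta> K U1 e1 lam1"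
    and gple2: "gen_principal_lyapunov_exponent M T \<theta> K U2 e2 lam2"
  shows "lam1 \<le> lam2"
proof -
  interpret A: skew_product M T \<theta> U1 by (rule sds1)
  interpret B: skew_product M T \<theta> U2 by (rule sds2)
  have K: "order_cone K"
    using lattice by (simp add: banach_lattice_def)
  have t: "t0 \<in> nonneg_times T" and t_pos: "0 < t0"
    using t0 by (auto simp: nonneg_times_def)
  obtain \<kappa> where foc: "focusing_towards M K U2 e2 \<kappa>"
    using foc2 by (auto simp: strongly_focusing_def)
  let ?F = "inf at_top (principal (nonneg_times T))"
  let ?good = "\<lambda>U lam \<omega> v. (\<forall>t\<in>nonneg_times T. blinfun_apply (U \<omega> t) v \<noteq> 0) \<and>
    ((\<lambda>t. ereal (1 / t * ln (norm (blinfun_apply (U \<omega> t) v)))) \<longlongrightarrow> lam) ?F"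
  have good1: "AE \<omega> in M. \<exists>v\<in>K - {0}. ?good U1 lam1 \<omega> v"
    by (rule A.gen_principal_lyapunov_exponent_pathwise[OF gple1])
  have good2: "AE \<omega> in M. \<exists>v\<in>K - {0}. ?good U2 lam2 \<omega> v"
    by (rule B.gen_principal_lyapunov_exponent_pathwise[OF gple2])
  have dom: "AE \<omega> in M. \<forall>n. \<forall>u\<in>K. cone_le K (blinfun_apply (U1 (\<theta> (real n * t0) \<omega>) t0) u)
                             (blinfun_apply (U2 (\<theta> (real n * t0) \<omega>) t0) u)"
    by (rule A.AE_along_multiples[OF t le])
  obtain \<omega> v1 v2 where w: "\<omega> \<in> space M" and v: "v1 \<in> K - {0}" "v2 \<in> K - {0}"
    and good: "?good U1 lam1 \<omega> v1" "?good U2 lam2 \<omega> v2"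
    and le_orbit: "\<And>n u. u \<in> K \<Longrightarrow> cone_le K (blinfun_apply (U1 (\<theta> (real n * t0) \<omega>) t0) u)
                                  (blinfun_apply (U2 (\<theta> (real n * t0) \<omega>) t0) u)"
    using eventually_happens'[OF A.ae_filter_bot eventually_conj[OF AE_space
        eventually_conj[OF good1 eventually_conj[OF good2 dom]]]]
    by (elim exE conjE bexE) (rule that; blast)
  obtain C where C: "0 < C" "\<And>t. t \<in> nonneg_times T \<Longrightarrow> 1 \<le> t \<Longrightarrow>
      cone_le K (blinfun_apply (U2 \<omega> t) v1) (C *\<^sub>R blinfun_apply (U2 \<omega> t) v2)"
    using B.focusing_orbits_comparable[OF K pos2 foc w v] by blast
  let ?s = "\<lambda>n. real n * t0"
  have s: "?s n \<in> nonneg_times T" for n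
    by (rule A.nonneg_times_multiple[OF t])
  have top: "filterlim ?s at_top sequentially"
    using t_pos by (intro filterlim_at_top_mult_tendsto_pos[OF tendsto_const]
        filterlim_real_sequentially)
  have norm_le: "norm (blinfun_apply (U1 \<omega> (?s n)) v1) \<le> C * norm (blinfun_apply (U2 \<omega> (?s n)) v2)"
    if "1 \<le> ?s n" for n
  proof -
    have "cone_le K (blinfun_apply (U1 \<omega> (?s n)) v1) (blinfun_apply (U2 \<omega> (?s n)) v1)"
      using v by (intro cocycle_domination_multiples[OF sds1 sds2 K pos1 pos2 t w _ le_orbit]) auto
    then have "cone_le K (blinfun_apply (U1 \<omega> (?s n)) v1) (C *\<^sub>R blinfun_apply (U2 \<omega> (?s n)) v2)"
      by (rule cone_le_trans[OF K _ C(2)[OF s that]])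
    moreover have "blinfun_apply (U1 \<omega> (?s n)) v1 \<in> K"
      using positive_sds_cone[OF pos1 w s] v by blast
    ultimately show ?thesis
      using banach_lattice_norm_mono[OF lattice] C(1) by fastforce
  qed
  show ?thesis
  proof (rule growth_rate_le[OF conjunct2[OF good(1)] conjunct2[OF good(2)] _ top C(1)])
    show "filterlim ?s ?F sequentially"
      using top s by (simp add: filterlim_inf filterlim_principal)
    have "\<forall>\<^sub>F n in sequentially. 1 \<le> ?s n"
      using top by (auto simp: filterlim_at_top)
    then show "\<forall>\<^sub>F n in sequentially. 0 < norm (blinfun_apply (U1 \<omega> (?s n)) v1) \<and>
        norm (blinfun_apply (U1 \<omega> (?s n)) v1) \<le> C * norm (blinfun_apply (U2 \<omega> (?s n)) v2)"
    proof eventually_elim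
      case (elim n)
      then show ?case
        using norm_le good(1) s by simp
    qed
  qed
qed

end
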